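(* Let $\gamma\in(0,1)$, let the supply and demand assumptions in the context hold, let $t\in[0,1/2]$, and let the customer loyalty depend on the announced prices by $$\beta(p_1,p_2)=\begin{cases}1/2 & \text{if } p_1=p_2,\\ 1/2+t & \text{if } p_1<p_2,\\ 1/2-t & \text{if } p_1>p_2.\end{cases}$$ Then a pure strategy Nash equilibrium always exists for the throughput competition game and for the revenue competition game.
   Context: Supply and demand assumptions. $w(p)>0$ (supply) and $c(p)>0$ (demand) are real-valued functions of the price $p>0$; $c$ is strictly decreasing, $w$ is strictly increasing; $0<p_L<p_H$; there is a unique price $p_{\rm bal}$ with $w(\gamma p_{\rm bal})=c(p_{\rm bal})$. Games. Two platforms simultaneously choose prices $p_1$ (Platform 1) and $p_2$ (Platform 2) in $\{p_L,p_H\}$. Given $(p_1,p_2)$, write $\beta=\beta(p_1,p_2)$ and let $$T(p_1,p_2)=\min\Big\{\tfrac{w(\gamma p_1)}{\beta},\tfrac{w(\gamma p_2)}{1-\beta},\tfrac{c(p_1)}{\beta},\tfrac{c(p_2)}{1-\beta},c(\min\{p_1,p_2\}),w(\max\{\gamma p_1,\gamma p_2\})\Big\},$$ where a term with zero denominator is read as $+\infty$ (i.e. omitted). The throughputs of the platforms are $N_1=\beta\,T$ and $N_2=(1-\beta)\,T$. (These are the numbers of matched worker–customer pairs at the two platforms in the aggregate-utility-maximizing allocation of users when a fraction $\beta$ of the served customers is served at Platform 1.) In the throughput game the payoff of Platform $i$ is $N_i(p_1,p_2)$; in the revenue game it is $(1-\gamma)\,p_i\,N_i(p_1,p_2)$.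 A pair of strategies is a pure strategy Nash equilibrium if no platform can strictly increase its payoff by a unilateral change of strategy. *)

theory Defs
  imports Complex_Main
begin

definition supply_demand :: "real \<Rightarrow> (real \<Rightarrow> real) \<Rightarrow> (real \<Rightarrow> real) \<Rightarrow> bool" where
  "supply_demand \<gamma> w c \<longleftrightarrow>
     (\<forall>p>0. w p > 0) \<and> (\<forall>p>0. c p > 0) \<and>
     strict_mono_on {0<..} w \<and> strict_antimono_on {0<..} c \<and>
     (\<exists>!p. p > 0 \<and> w (\<gamma> * p) = c p)"

definition loyalty :: "real \<Rightarrow> real \<Rightarrow> real \<Rightarrow> real" where
  "loyalty t p1 p2 = (if p1 = p2 then 1/2 else if p1 < p2 then 1/2 + t else 1/2 - t)"

(* HOL has x / 0 = 0, so the terms with denominator zero (to be read as +infinity)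
   are explicitly left out of the minimum. *)
definition total_throughput ::
  "real \<Rightarrow> (real \<Rightarrow> real) \<Rightarrow> (real \<Rightarrow> real) \<Rightarrow> (real \<Rightarrow> real \<Rightarrow> real) \<Rightarrow> real \<Rightarrow> real \<Rightarrow> real" where
  "total_throughput \<gamma> w c \<beta> p1 p2 =
     (let b = \<beta> p1 p2 in
      Min ((if b = 0 then {} else {w (\<gamma> * p1) / b, c p1 / b}) \<union>
           (if 1 - b = 0 then {} else {w (\<gamma> * p2) / (1 - b), c p2 / (1 - b)}) \<union>
           {c (min p1 p2), w (max (\<gamma> * p1) (\<gamma> * p2))}))"

definition throughput1 ::
  "real \<Rightarrow> (real \<Rightarrow> real) \<Rightarrow> (real \<Rightarrow> real) \<Rightarrow> (real \<Rightarrow> real \<Rightarrow> real) \<Rightarrow> real \<Rightarrow> real \<Rightarrow> real" where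
  "throughput1 \<gamma> w c \<beta> p1 p2 = \<beta> p1 p2 * total_throughput \<gamma> w c \<beta> p1 p2"

definition throughput2 ::
  "real \<Rightarrow> (real \<Rightarrow> real) \<Rightarrow> (real \<Rightarrow> real) \<Rightarrow> (real \<Rightarrow> real \<Rightarrow> real) \<Rightarrow> real \<Rightarrow> real \<Rightarrow> real" where
  "throughput2 \<gamma> w c \<beta> p1 p2 = (1 - \<beta> p1 p2) * total_throughput \<gamma> w c \<beta> p1 p2"

definition revenue1 ::
  "real \<Rightarrow> (real \<Rightarrow> real) \<Rightarrow> (real \<Rightarrow> real) \<Rightarrow> (real \<Rightarrow> real \<Rightarrow> real) \<Rightarrow> real \<Rightarrow> real \<Rightarrow> real" where
  "revenue1 \<gamma> w c \<beta> p1 p2 = (1 - \<gamma>) * p1 * throughput1 \<gamma> w c \<beta> p1 p2"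

definition revenue2 ::
  "real \<Rightarrow> (real \<Rightarrow> real) \<Rightarrow> (real \<Rightarrow> real) \<Rightarrow> (real \<Rightarrow> real \<Rightarrow> real) \<Rightarrow> real \<Rightarrow> real \<Rightarrow> real" where
  "revenue2 \<gamma> w c \<beta> p1 p2 = (1 - \<gamma>) * p2 * throughput2 \<gamma> w c \<beta> p1 p2"

(* Both payoff functions take Platform 1's strategy as first argument. *)
definition pure_nash ::
  "'s set \<Rightarrow> ('s \<Rightarrow> 's \<Rightarrow> real) \<Rightarrow> ('s \<Rightarrow> 's \<Rightarrow> real) \<Rightarrow> 's \<Rightarrow> 's \<Rightarrow> bool" where
  "pure_nash S u1 u2 s1 s2 \<longleftrightarrow>
     s1 \<in> S \<and> s2 \<in> S \<and>
     \<not> (\<exists>s\<in>S. u1 s s2 > u1 s1 s2) \<and>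
     \<not> (\<exists>s\<in>S. u2 s1 s > u2 s1 s2)"

end

theory Submission imports Defs begin

text \<open>
  Both games are symmetric: the loyalty function treats the two platforms alike, and so does the
  total throughput, so exchanging the prices exchanges the payoffs. A symmetric game in which each
  player has two strategies \<open>a\<close> and \<open>b\<close> always has a pure equilibrium. If neither \<open>(a, a)\<close> nor
  \<open>(b, b)\<close> is one, then it pays to answer \<open>a\<close> by \<open>b\<close> and to answer \<open>b\<close> by \<open>a\<close>. By
  symmetry the first inequality may be read for Player 2 and the second for Player 1, and together
  they say that \<open>(a, b)\<close> is an equilibrium (\<open>symmetric_two_strategy_pure_nash\<close>).
\<close>

lemma symmetric_two_strategy_pure_nash:
  assumes sym: "\<And>x y. u2 x y = u1 y x"
  shows "\<exists>x y. pure_nash {a, b} u1 u2 x y"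
proof (cases "u1 b a \<le> u1 a a \<or> u1 a b \<le> u1 b b")
  case True
  then have "pure_nash {a, b} u1 u2 a a \<or> pure_nash {a, b} u1 u2 b b"
    by (auto simp: pure_nash_def sym)
  then show ?thesis by blast
next
  case False
  then have "pure_nash {a, b} u1 u2 a b"
    by (auto simp: pure_nash_def sym)
  then show ?thesis by blast
qed

lemma loyalty_swap: "loyalty t q p = 1 - loyalty t p q"
  by (simp add: loyalty_def)

text \<open>
  When the swap replaces the share of Platform 1 by its complement, it interchanges the two groups
  of terms that belong to a single platform, each with its own convention for a zero share, and
  the market-wide terms depend only on the unordered pair of prices.
\<close>

lemma total_throughput_swap:
  assumes "\<beta> q p = 1 - \<beta> p q"
  shows "total_throughput \<gamma> w c \<beta> q p = total_throughput \<gamma> w c \<beta> p q"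
  by (simp add: total_throughput_def Let_def assms min.commute max.commute Un_commute insert_commute)

lemma throughput_swap:
  "throughput2 \<gamma> w c (loyalty t) p q = throughput1 \<gamma> w c (loyalty t) q p"
  unfolding throughput1_def throughput2_def
  by (metis loyalty_swap total_throughput_swap)

lemma revenue_swap:
  "revenue2 \<gamma> w c (loyalty t) p q = revenue1 \<gamma> w c (loyalty t) q p"
  by (simp add: revenue1_def revenue2_def throughput_swap)

theorem theorem9:
  fixes \<gamma> t pL pH :: real and w c :: "real \<Rightarrow> real"
  assumes "0 < \<gamma>" and "\<gamma> < 1"
    and "supply_demand \<gamma> w c"
    and "0 < pL" and "pL < pH"
    and "0 \<le> t" and "t \<le> 1/2"
  shows "(\<exists>p1 p2. pure_nash {pL, pH} (throughput1 \<gamma> w c (loyalty t))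
                                      (throughput2 \<gamma> w c (loyalty t)) p1 p2) \<and>
         (\<exists>p1 p2. pure_nash {pL, pH} (revenue1 \<gamma> w c (loyalty t))
                                      (revenue2 \<gamma> w c (loyalty t)) p1 p2)"
  by (intro conjI symmetric_two_strategy_pure_nash throughput_swap revenue_swap)

end
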